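(* Let $G$ be a cylindrical electrical network, $G(\infty)$ its universal cover, and $G(1),G(2),\dots$ a sequence of truncations of $G(\infty)$. Then for all boundary vertices $u,v$ of $G(\infty)$ the limit $\mathcal{L}_{uv}=\lim_{N\to\infty}L_{uv}(G(N))$ exists and is finite, it does not depend on the choice of the sequence of truncations, and the resulting infinite matrix is periodic: $\mathcal{L}_{\gamma(u)\gamma(v)}=\mathcal{L}_{uv}$ for every deck transformation $\gamma$ of $G(\infty)$ (for the left boundary labelled by $\mathbb{Z}$ with $n$ vertices per period, $\mathcal{L}_{ij}=\mathcal{L}_{(i+n)(j+n)}$).
   Context: An electrical network is a graph with positive edge conductances and vertices partitioned into boundary and interior; for a finite network the response matrix $L$ is the Schur complement $K/K_{I,I}$ of the Kirchhoff matrix $K$ ($K_{uv}=\sum_{e\text{ joins }u,v}w(e)$ for $u\neq v$, $K_{uu}=-\sum_{e\ni u}w(e)$) with respect to the interior vertices $I$. A cylindrical electrical network is a finite electrical network embedded in a cylinder $S^1\times[0,1]$ so that its intersection with the boundary of the cylinder is exactly its set of boundary vertices. Its universal cover $G(\infty)$ is the infinite periodic network obtained by lifting to the universal cover $\mathbb{R}\times[0,1]$ (an infinite strip), with lifted conductances and lifted boundary/interior status; its boundary vertices on one side are numbered by $\mathbb{Z}$ in order, and on the other side by $\mathbb{Z}'$. Given finite vertex sets $V_1\subseteq V_2\subseteq\cdots$ of $G(\infty)$ whose union is all vertices, the truncation $G(N)$ is the finite subgraph consisting of all edges incident to a vertex of $V_N$ (with their endpoints); a vertex of $G(N)$ is interior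 iff it lies in $V_N$ and is interior in $G(\infty)$, otherwise it is a boundary vertex of $G(N)$. For fixed $u,v$, both are boundary vertices of $G(N)$ for all large $N$. *)

theory Defs
  imports "HOL-Analysis.Analysis"
begin

section \<open>Schur complements\<close>

text \<open>
  Matrices are functions, and only the entries indexed by the sets in question matter.
\<close>

definition inverse_on :: "'v set \<Rightarrow> ('v \<Rightarrow> 'v \<Rightarrow> real) \<Rightarrow> ('v \<Rightarrow> 'v \<Rightarrow> real) \<Rightarrow> bool" where
  "inverse_on I A X \<longleftrightarrow>
     (\<forall>a\<in>I. \<forall>b\<in>I. (\<Sum>c\<in>I. A a c * X c b) = (if a = b then 1 else 0)
                 \<and> (\<Sum>c\<in>I. X a c * A c b) = (if a = b then 1 else 0))"

definition generalized_inverse_on ::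
    "'v set \<Rightarrow> ('v \<Rightarrow> 'v \<Rightarrow> real) \<Rightarrow> ('v \<Rightarrow> 'v \<Rightarrow> real) \<Rightarrow> bool" where
  "generalized_inverse_on I A X \<longleftrightarrow>
     (\<forall>a\<in>I. \<forall>b\<in>I. (\<Sum>c\<in>I. \<Sum>d\<in>I. A a c * X c d * A d b) = A a b)"

text \<open>
  The Schur complement \<open>A / A\<^sub>I\<^sub>I\<close>.  If \<open>A\<^sub>I\<^sub>I\<close> is invertible, its only generalized inverse is
  the inverse, and this is the usual Schur complement (lemma \<open>schur_complement_inverse\<close>).
  The generalized inverse gives a value also when \<open>A\<^sub>I\<^sub>I\<close> is singular; for a Kirchhoff matrix
  this happens when some connected component has interior vertices only.
\<close>

definition schur_complement ::
    "('v \<Rightarrow> 'v \<Rightarrow> real) \<Rightarrow> 'v set \<Rightarrow> 'v \<Rightarrow> 'v \<Rightarrow> real" where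
  "schur_complement A I u v =
     A u v - (\<Sum>a\<in>I. \<Sum>b\<in>I. A u a * (SOME X. generalized_inverse_on I A X) a b * A b v)"

lemma generalized_inverse_on_unique:
  assumes I: "finite I" and Y: "inverse_on I A Y" and X: "generalized_inverse_on I A X"
    and a: "a \<in> I" and b: "b \<in> I"
  shows "X a b = Y a b"
proof -
  have YA: "(\<Sum>c\<in>I. Y a c * A c d) = (if a = d then 1 else 0)" if "d \<in> I" for d
    using Y a that by (auto simp: inverse_on_def)
  have AY: "(\<Sum>c\<in>I. A d c * Y c b) = (if d = b then 1 else 0)" if "d \<in> I" for d
    using Y b that by (auto simp: inverse_on_def)
  have AXA: "(\<Sum>e\<in>I. \<Sum>f\<in>I. A c e * X e f * A f d) = A c d" if "c \<in> I" "d \<in> I" for c d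
    using X that by (auto simp: generalized_inverse_on_def)
  have L: "(\<Sum>f\<in>I. X a f * A f d) = (if a = d then 1 else 0)" if d: "d \<in> I" for d
  proof -
    have "(\<Sum>f\<in>I. X a f * A f d)
        = (\<Sum>e\<in>I. (if a = e then 1 else 0) * (\<Sum>f\<in>I. X e f * A f d))"
      using I a by (simp add: if_distrib[of "\<lambda>x. x * _"] cong: if_cong)
    also have "\<dots> = (\<Sum>e\<in>I. (\<Sum>c\<in>I. Y a c * A c e) * (\<Sum>f\<in>I. X e f * A f d))"
      by (rule sum.cong) (simp_all add: YA)
    also have "\<dots> = (\<Sum>c\<in>I. Y a c * (\<Sum>e\<in>I. \<Sum>f\<in>I. A c e * X e f * A f d))"
      unfolding sum_distrib_right
      by (subst sum.swap) (simp add: sum_distrib_left mult.assoc)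
    also have "\<dots> = (\<Sum>c\<in>I. Y a c * A c d)"
      by (rule sum.cong) (simp_all add: AXA d)
    finally show ?thesis using YA d by simp
  qed
  have "X a b = (\<Sum>f\<in>I. X a f * (\<Sum>c\<in>I. A f c * Y c b))"
    using I b by (simp add: AY if_distrib cong: if_cong)
  also have "\<dots> = (\<Sum>c\<in>I. (\<Sum>f\<in>I. X a f * A f c) * Y c b)"
    unfolding sum_distrib_left sum_distrib_right
    by (subst sum.swap) (simp add: mult.assoc)
  also have "\<dots> = Y a b"
    using I a by (simp add: L if_distrib[of "\<lambda>x. x * _"] cong: if_cong)
  finally show ?thesis .
qed

lemma schur_complement_inverse:
  assumes I: "finite I" and Y: "inverse_on I A Y"
  shows "schur_complement A I u v = A u v - (\<Sum>a\<in>I. \<Sum>b\<in>I. A u a * Y a b * A b v)"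
proof -
  have "generalized_inverse_on I A Y"
    unfolding generalized_inverse_on_def
  proof (intro ballI)
    fix a b assume ab: "a \<in> I" "b \<in> I"
    have "(\<Sum>c\<in>I. \<Sum>d\<in>I. A a c * Y c d * A d b)
        = (\<Sum>c\<in>I. A a c * (\<Sum>d\<in>I. Y c d * A d b))"
      by (simp add: sum_distrib_left mult.assoc)
    also have "\<dots> = (\<Sum>c\<in>I. A a c * (if c = b then 1 else 0))"
      using Y ab by (intro sum.cong) (auto simp: inverse_on_def)
    also have "\<dots> = A a b"
      using I ab by (simp add: if_distrib cong: if_cong)
    finally show "(\<Sum>c\<in>I. \<Sum>d\<in>I. A a c * Y c d * A d b) = A a b" .
  qed
  then have "generalized_inverse_on I A (SOME X. generalized_inverse_on I A X)"
    by (rule someI[of "generalized_inverse_on I A"])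
  then show ?thesis
    unfolding schur_complement_def
    using generalized_inverse_on_unique[OF I Y] by (auto intro!: sum.cong)
qed


section \<open>Electrical networks\<close>

text \<open>Multiple edges are allowed; a loop at \<open>u\<close> is an edge with \<open>ends = {u}\<close>.\<close>

record ('v, 'e) network =
  verts :: "'v set"
  edges :: "'e set"
  ends :: "'e \<Rightarrow> 'v set"
  conductance :: "'e \<Rightarrow> real"
  bdry :: "'v set"

definition electrical_network :: "('v, 'e, 'z) network_scheme \<Rightarrow> bool" where
  "electrical_network N \<longleftrightarrow>
     (\<forall>e\<in>edges N. \<exists>u\<in>verts N. \<exists>v\<in>verts N. ends N e = {u, v}) \<and>
     (\<forall>e\<in>edges N. 0 < conductance N e) \<and>
     bdry N \<subseteq> verts N"

text \<open>
  The diagonal sum runs over all edges incident to \<open>u\<close>, so a loop at \<open>u\<close> occurs in it, once.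
\<close>

definition kirchhoff :: "('v, 'e, 'z) network_scheme \<Rightarrow> 'v \<Rightarrow> 'v \<Rightarrow> real" where
  "kirchhoff N u v =
     (if u = v then - (\<Sum>e\<in>{e \<in> edges N. u \<in> ends N e}. conductance N e)
      else (\<Sum>e\<in>{e \<in> edges N. ends N e = {u, v}}. conductance N e))"

text \<open>The response matrix; only the entries at boundary vertices \<open>u\<close>, \<open>v\<close> are of interest.\<close>

definition response_matrix :: "('v, 'e, 'z) network_scheme \<Rightarrow> 'v \<Rightarrow> 'v \<Rightarrow> real" where
  "response_matrix N = schur_complement (kirchhoff N) (verts N - bdry N)"


section \<open>Cylindrical networks and the universal cover\<close>

definition cylinder :: "(complex \<times> real) set" where
  "cylinder = sphere 0 1 \<times> {0..1}"

definition cylinder_bdry :: "(complex \<times> real) set" where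
  "cylinder_bdry = sphere 0 1 \<times> {0, 1}"

definition strip :: "(real \<times> real) set" where
  "strip = UNIV \<times> {0..1}"

definition cover_proj :: "real \<times> real \<Rightarrow> complex \<times> real" where
  "cover_proj x = (cis (2 * pi * fst x), snd x)"

text \<open>
  The vertices of an embedded network are points of the cylinder and each edge is drawn as a
  curve.  An edge may be a loop (for example one going around the cylinder), hence
  \<^const>\<open>simple_path\<close> and not \<^const>\<open>arc\<close>.
\<close>

record 'e embedded_network = "(complex \<times> real, 'e) network" +
  curve :: "'e \<Rightarrow> real \<Rightarrow> complex \<times> real"

definition cylindrical_network :: "('e, 'z) embedded_network_scheme \<Rightarrow> bool" where
  "cylindrical_network G \<longleftrightarrow>
     electrical_network G \<and> finite (verts G) \<and> finite (edges G) \<and>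
     verts G \<subseteq> cylinder \<and>
     (\<forall>e\<in>edges G. simple_path (curve G e) \<and> path_image (curve G e) \<subseteq> cylinder \<and>
        ends G e = {pathstart (curve G e), pathfinish (curve G e)} \<and>
        curve G e ` {0<..<1} \<inter> verts G = {}) \<and>
     (\<forall>e\<in>edges G. \<forall>f\<in>edges G. e \<noteq> f \<longrightarrow>
        curve G e ` {0<..<1} \<inter> curve G f ` {0<..<1} = {}) \<and>
     (verts G \<union> (\<Union>e\<in>edges G. path_image (curve G e))) \<inter> cylinder_bdry = bdry G"

text \<open>
  The edges of the universal cover over \<open>e\<close> are the lifts of the curve of \<open>e\<close> to the strip.
  They are taken extensional on \<open>{0..1}\<close> so that each lift is counted once.
\<close>

definition lifts :: "(real \<Rightarrow> complex \<times> real) \<Rightarrow> (real \<Rightarrow> real \<times> real) set" where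
  "lifts g = {q \<in> extensional {0..1}. path q \<and> path_image q \<subseteq> strip \<and>
                (\<forall>t\<in>{0..1}. cover_proj (q t) = g t)}"

definition universal_cover ::
    "('e, 'z) embedded_network_scheme \<Rightarrow> (real \<times> real, 'e \<times> (real \<Rightarrow> real \<times> real)) network" where
  "universal_cover G =
     \<lparr> verts = {x \<in> strip. cover_proj x \<in> verts G},
       edges = {(e, q). e \<in> edges G \<and> q \<in> lifts (curve G e)},
       ends = (\<lambda>(e, q). {pathstart q, pathfinish q}),
       conductance = (\<lambda>(e, q). conductance G e),
       bdry = {x \<in> strip. cover_proj x \<in> bdry G} \<rparr>"

definition deck_transformation :: "(real \<times> real \<Rightarrow> real \<times> real) \<Rightarrow> bool" where
  "deck_transformation \<gamma> \<longleftrightarrow>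
     (\<exists>\<gamma>'. homeomorphism strip strip \<gamma> \<gamma>') \<and> (\<forall>x\<in>strip. cover_proj (\<gamma> x) = cover_proj x)"

text \<open>
  A numbering by \<open>\<int>\<close>, in order, of the boundary vertices of the universal cover on the side
  \<open>\<real> \<times> {s}\<close> of the strip, where \<open>s\<close> is \<open>0\<close> or \<open>1\<close>; the number of these vertices per period is
  the number of boundary vertices of the cylindrical network on the corresponding circle.
\<close>

definition boundary_numbering ::
    "('e, 'z) embedded_network_scheme \<Rightarrow> real \<Rightarrow> (int \<Rightarrow> real \<times> real) \<Rightarrow> bool" where
  "boundary_numbering G s l \<longleftrightarrow>
     bij_betw l UNIV {x \<in> bdry (universal_cover G). snd x = s} \<and> strict_mono (\<lambda>i. fst (l i))"

definition vertices_per_period :: "('e, 'z) embedded_network_scheme \<Rightarrow> real \<Rightarrow> nat" where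
  "vertices_per_period G s = card {x \<in> bdry G. snd x = s}"


section \<open>Truncations\<close>

definition exhaustion :: "('v, 'e, 'z) network_scheme \<Rightarrow> (nat \<Rightarrow> 'v set) \<Rightarrow> bool" where
  "exhaustion N V \<longleftrightarrow> (\<forall>k. finite (V k)) \<and> incseq V \<and> (\<Union>k. V k) = verts N"

text \<open>
  The vertices in \<open>W\<close> are kept even if they are isolated, so that every vertex of the network
  belongs to all sufficiently late truncations.
\<close>

definition truncation :: "('v, 'e, 'z) network_scheme \<Rightarrow> 'v set \<Rightarrow> ('v, 'e) network" where
  "truncation N W =
     (let E = {e \<in> edges N. ends N e \<inter> W \<noteq> {}};
          U = W \<union> (\<Union>e\<in>E. ends N e)
      in \<lparr> verts = U, edges = E, ends = ends N, conductance = conductance N,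
           bdry = U - (W - bdry N) \<rparr>)"

definition truncated_response ::
    "('e, 'z) embedded_network_scheme \<Rightarrow> (nat \<Rightarrow> (real \<times> real) set) \<Rightarrow>
       real \<times> real \<Rightarrow> real \<times> real \<Rightarrow> nat \<Rightarrow> real" where
  "truncated_response G V u v k = response_matrix (truncation (universal_cover G) (V k)) u v"

definition limit_response ::
    "('e, 'z) embedded_network_scheme \<Rightarrow> (nat \<Rightarrow> (real \<times> real) set) \<Rightarrow>
       real \<times> real \<Rightarrow> real \<times> real \<Rightarrow> real" where
  "limit_response G V u v = lim (truncated_response G V u v)"

end

theory Submission
  imports Defs "HOL-Library.Function_Algebras"
begin

text \<open>
  For boundary vertices \<open>u\<close>, \<open>v\<close> and a finite set \<open>I\<close> of interior vertices, the response is
  \<open>K u v + (\<Sum>d\<in>I. K u d * f d)\<close>, where \<open>f\<close> is the potential with value \<open>1\<close> at \<open>v\<close> and \<open>0\<close> at the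
  other vertices outside \<open>I\<close>.  Taking for \<open>f\<close> the limit of the Jacobi iteration started at \<open>0\<close>
  settles existence also for singular \<open>K\<^sub>I\<^sub>I\<close>, and shows \<open>0 \<le> f \<le> 1\<close> and that \<open>f\<close> increases with
  \<open>I\<close>.  So the response increases with \<open>I\<close> and is bounded, and along every exhaustion it tends to
  its supremum over all finite \<open>I\<close>.  This supremum is invariant under automorphisms of the
  network, in particular under deck transformations.  In a numbering of one side of the boundary,
  translation by one period is an order automorphism of \<open>\<int>\<close>, hence a shift.
\<close>

section \<open>Generalized inverses\<close>

text \<open>Read \<open>A\<close> on \<open>I\<close> as a linear map \<open>T\<close>. A linear
  right inverse \<open>g\<close> of \<open>T\<close> on its image satisfies
  \<open>T g T = T\<close>, and the matrix of \<open>g\<close> is a generalized inverse. So the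
  \<open>SOME\<close> in \<open>schur_complement\<close> is meaningful even for a singular
  block.\<close>

lemma ex_generalized_inverse_on:
  fixes A :: "'v \<Rightarrow> 'v \<Rightarrow> real"
  assumes I: "finite I"
  shows "\<exists>X. generalized_inverse_on I A X"
proof -
  \<comment> \<open>Pointwise scaling turns all functions \<open>'v \<Rightarrow> real\<close> into
    a vector space, even for infinite \<open>'v\<close>.\<close>
  define s :: "real \<Rightarrow> ('v \<Rightarrow> real) \<Rightarrow> 'v \<Rightarrow> real" where "s = (\<lambda>r f x. r * f x)"
  interpret vector_space s
    by unfold_locales (auto simp: s_def fun_eq_iff algebra_simps)
  interpret P: vector_space_pair s s ..
  \<comment> \<open>The cut-off to 0 outside \<open>I\<close> makes \<open>T (\<delta> b)\<close> a
    finite combination of the unit vectors \<open>\<delta> d\<close> with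
    \<open>d \<in> I\<close>.\<close>
  define T where "T f = (\<lambda>a. if a \<in> I then (\<Sum>c\<in>I. A a c * f c) else 0)" for f :: "'v \<Rightarrow> real"
  have T: "Vector_Spaces.linear s s T"
    unfolding Vector_Spaces.linear_iff using vector_space_axioms
    by (auto simp: T_def s_def fun_eq_iff algebra_simps sum.distrib sum_distrib_left)
  from P.linear_exists_right_inverse_on[OF T subspace_UNIV]
  obtain g where g: "Vector_Spaces.linear s s g" and TgT: "T (g (T f)) = T f" for f
    by auto
  interpret g: Vector_Spaces.linear s s g by (rule g)
  define \<delta> :: "'v \<Rightarrow> 'v \<Rightarrow> real" where "\<delta> d = (\<lambda>a. if a = d then 1 else 0)" for d
  have sum_fun: "(\<Sum>d\<in>S. h d) c = (\<Sum>d\<in>S. h d c)" if "finite S"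
    for S and h :: "'v \<Rightarrow> 'v \<Rightarrow> real" and c
    using that by (induction S) auto
  have "(\<Sum>c\<in>I. \<Sum>d\<in>I. A a c * g (\<delta> d) c * A d b) = A a b" if a: "a \<in> I" and b: "b \<in> I" for a b
  proof -
    have T\<delta>: "T (\<delta> b) = (\<lambda>a. if a \<in> I then A a b else 0)"
      using I b by (auto simp: T_def \<delta>_def fun_eq_iff if_distrib cong: if_cong)
    also have "\<dots> = (\<Sum>d\<in>I. s (A d b) (\<delta> d))"
      using I by (auto simp: fun_eq_iff sum_fun s_def \<delta>_def if_distrib cong: if_cong)
    finally have "g (T (\<delta> b)) = (\<Sum>d\<in>I. s (A d b) (g (\<delta> d)))"
      by (simp add: g.sum g.scale)
    then have "T (g (T (\<delta> b))) a = (\<Sum>c\<in>I. A a c * (\<Sum>d\<in>I. A d b * g (\<delta> d) c))"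
      using a I by (simp add: T_def sum_fun s_def)
    then show ?thesis
      using a TgT[of "\<delta> b"] by (simp add: T\<delta> sum_distrib_left mult_ac)
  qed
  then show ?thesis
    by (intro exI[of _ "\<lambda>c d. g (\<delta> d) c"]) (auto simp: generalized_inverse_on_def)
qed

text \<open>With \<open>X\<close> the chosen generalized inverse, row \<open>u\<close> is
  \<open>- x A\<close> and column \<open>v\<close> is \<open>- A y\<close>, so the correction term
  is \<open>x A X A y = x A y\<close>, which no longer involves \<open>X\<close>. Solvability of the
  two systems replaces invertibility.\<close>

lemma schur_complement_eq:
  fixes A :: "'v \<Rightarrow> 'v \<Rightarrow> real"
  assumes I: "finite I"
    and x: "\<And>b. b \<in> I \<Longrightarrow> (\<Sum>c\<in>I. x c * A c b) = - A u b"
    and y: "\<And>a. a \<in> I \<Longrightarrow> (\<Sum>d\<in>I. A a d * y d) = - A a v"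
  shows "schur_complement A I u v = A u v + (\<Sum>d\<in>I. A u d * y d)"
proof -
  define X where "X = (SOME X. generalized_inverse_on I A X)"
  have X: "(\<Sum>a\<in>I. \<Sum>b\<in>I. A c a * X a b * A b d) = A c d" if "c \<in> I" "d \<in> I" for c d
    using someI_ex[OF ex_generalized_inverse_on[OF I, of A]] that
    by (auto simp: X_def generalized_inverse_on_def)
  have triple: "(\<Sum>c\<in>I. f c) * r * (\<Sum>d\<in>I. g d) = (\<Sum>c\<in>I. \<Sum>d\<in>I. f c * r * g d)"
    for f g and r :: real
    by (simp add: sum_distrib_right[of f I r] sum_product)
  have "(\<Sum>a\<in>I. \<Sum>b\<in>I. A u a * X a b * A b v)
      = (\<Sum>a\<in>I. \<Sum>b\<in>I. (\<Sum>c\<in>I. x c * A c a) * X a b * (\<Sum>d\<in>I. A b d * y d))"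
    by (intro sum.cong refl) (simp add: x y)
  also have "\<dots> = (\<Sum>a\<in>I. \<Sum>b\<in>I. \<Sum>c\<in>I. \<Sum>d\<in>I. x c * (A c a * X a b * A b d) * y d)"
    by (simp add: triple) (simp add: mult.assoc)
  \<comment> \<open>The sums are swapped until those over \<open>a\<close> and \<open>b\<close> are
    innermost, where \<open>X\<close> can be eliminated.\<close>
  also have "\<dots> = (\<Sum>a\<in>I. \<Sum>c\<in>I. \<Sum>b\<in>I. \<Sum>d\<in>I. x c * (A c a * X a b * A b d) * y d)"
    by (intro sum.cong refl sum.swap)
  also have "\<dots> = (\<Sum>c\<in>I. \<Sum>a\<in>I. \<Sum>b\<in>I. \<Sum>d\<in>I. x c * (A c a * X a b * A b d) * y d)"
    by (rule sum.swap)
  also have "\<dots> = (\<Sum>c\<in>I. \<Sum>a\<in>I. \<Sum>d\<in>I. \<Sum>b\<in>I. x c * (A c a * X a b * A b d) * y d)"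
    by (intro sum.cong refl sum.swap)
  also have "\<dots> = (\<Sum>c\<in>I. \<Sum>d\<in>I. \<Sum>a\<in>I. \<Sum>b\<in>I. x c * (A c a * X a b * A b d) * y d)"
    by (intro sum.cong refl sum.swap)
  also have "\<dots> = (\<Sum>c\<in>I. \<Sum>d\<in>I. x c * (\<Sum>a\<in>I. \<Sum>b\<in>I. A c a * X a b * A b d) * y d)"
    by (simp add: sum_distrib_left sum_distrib_right)
  also have "\<dots> = (\<Sum>c\<in>I. \<Sum>d\<in>I. x c * A c d * y d)"
    by (intro sum.cong refl) (simp add: X)
  also have "\<dots> = (\<Sum>d\<in>I. (\<Sum>c\<in>I. x c * A c d) * y d)"
    by (subst sum.swap) (simp add: sum_distrib_right)
  also have "\<dots> = - (\<Sum>d\<in>I. A u d * y d)"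
    by (simp add: x sum_negf)
  finally show ?thesis
    by (simp add: schur_complement_def X_def)
qed

text \<open>Both matrices have the same generalized inverses on \<open>I\<close>, hence
  \<open>SOME\<close> picks the same one.\<close>

lemma schur_complement_cong:
  assumes "\<And>a b. a \<in> insert u I \<Longrightarrow> b \<in> insert v I \<Longrightarrow> A a b = B a b"
  shows "schur_complement A I u v = schur_complement B I u v"
proof -
  have "generalized_inverse_on I A X = generalized_inverse_on I B X" for X
    using assms by (auto simp: generalized_inverse_on_def)
  with assms show ?thesis
    by (simp add: schur_complement_def)
qed


section \<open>Potentials\<close>

text \<open>
  Jacobi iteration for the potential that is \<open>1\<close> at \<open>v\<close> and \<open>0\<close> at the other vertices outside
  \<open>I\<close>.  An isolated \<open>a\<close> has \<open>K a a = 0\<close> and gets the value \<open>0\<close>, since \<open>x / 0 = 0\<close>.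
\<close>

primrec jacobi :: "('v \<Rightarrow> 'v \<Rightarrow> real) \<Rightarrow> 'v set \<Rightarrow> 'v \<Rightarrow> nat \<Rightarrow> 'v \<Rightarrow> real" where
  "jacobi K I v 0 = (\<lambda>a. 0)"
| "jacobi K I v (Suc n) =
     (\<lambda>a. (K a v + (\<Sum>b\<in>I - {a}. K a b * jacobi K I v n b)) / (- K a a))"

definition potential :: "('v \<Rightarrow> 'v \<Rightarrow> real) \<Rightarrow> 'v set \<Rightarrow> 'v \<Rightarrow> 'v \<Rightarrow> real" where
  "potential K I v a = lim (\<lambda>n. jacobi K I v n a)"

definition inner_response :: "('v \<Rightarrow> 'v \<Rightarrow> real) \<Rightarrow> 'v set \<Rightarrow> 'v \<Rightarrow> 'v \<Rightarrow> real" where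
  "inner_response K I u v = (\<Sum>d\<in>I. K u d * potential K I v d)"

text \<open>
  Since \<open>inner_response K I u v\<close> is monotone in \<open>I\<close>, this is the limit of the Schur complements
  over the finite \<open>I \<subseteq> J\<close>.
\<close>

definition sup_response :: "('v \<Rightarrow> 'v \<Rightarrow> real) \<Rightarrow> 'v set \<Rightarrow> 'v \<Rightarrow> 'v \<Rightarrow> real" where
  "sup_response K J u v = K u v + (SUP I\<in>{I. finite I \<and> I \<subseteq> J}. inner_response K I u v)"

lemma eventually_subset_incseq:
  assumes "finite I" "I \<subseteq> (\<Union>k. W k)" "incseq W"
  shows "\<forall>\<^sub>F k in sequentially. I \<subseteq> W k"
proof -
  have "\<forall>\<^sub>F k in sequentially. x \<in> W k" if x: "x \<in> I" for x
  proof -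
    obtain m where "x \<in> W m" using x assms(2) by blast
    then show ?thesis
      using incseqD[OF assms(3)] by (auto simp: eventually_sequentially)
  qed
  then show ?thesis
    using assms(1) by (simp add: subset_eq eventually_ball_finite)
qed

text \<open>Row sums satisfy only an inequality because \<open>S\<close> may omit neighbours of
  \<open>a\<close> and because loops contribute to the diagonal alone. Finite \<open>S\<close>
  suffices for infinite networks.\<close>

locale kirchhoff_matrix =
  fixes K :: "'v \<Rightarrow> 'v \<Rightarrow> real"
  assumes sym: "K a b = K b a"
    and nonneg: "a \<noteq> b \<Longrightarrow> 0 \<le> K a b"
    and row_sum: "finite S \<Longrightarrow> a \<in> S \<Longrightarrow> (\<Sum>b\<in>S. K a b) \<le> 0"
begin

section \<open>Bounds and monotonicity of the Jacobi iteration\<close>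

lemma off_diagonal_sum:
  assumes "finite S" "a \<notin> S"
  shows "(\<Sum>b\<in>S. K a b) \<le> - K a a"
  using row_sum[of "insert a S" a] assms by simp

lemma diagonal_nonpos: "K a a \<le> 0"
  using row_sum[of "{a}" a] by simp

text \<open>At \<open>a = v\<close> the formula would involve the nonpositive entry
  \<open>K v v\<close>, so \<open>v\<close> is excluded. Values at other \<open>a\<close> outside
  \<open>I\<close> are harmless: the recursion sums only over \<open>I\<close>.\<close>

lemma jacobi_nonneg:
  assumes "v \<notin> I" "a \<noteq> v"
  shows "0 \<le> jacobi K I v n a"
  using assms(2)
proof (induction n arbitrary: a)
  case (Suc n)
  have "0 \<le> (\<Sum>b\<in>I - {a}. K a b * jacobi K I v n b)"
    using assms(1) by (intro sum_nonneg mult_nonneg_nonneg nonneg Suc.IH) auto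
  then show ?case
    using nonneg[of a v] Suc.prems diagonal_nonpos[of a]
    by (auto intro!: divide_nonneg_nonneg simp del: divide_minus_right)
qed simp

text \<open>By \<open>off_diagonal_sum\<close> each new value is a combination of numbers at most 1
  with nonnegative weights of sum at most 1. For \<open>K a a = 0\<close> the quotient is 0.\<close>

lemma jacobi_le_1:
  assumes I: "finite I" "v \<notin> I" and "a \<noteq> v"
  shows "jacobi K I v n a \<le> 1"
  using assms(3)
proof (induction n arbitrary: a)
  case (Suc n)
  have "K a v + (\<Sum>b\<in>I - {a}. K a b * jacobi K I v n b) \<le> K a v + (\<Sum>b\<in>I - {a}. K a b * 1)"
    using I by (intro add_left_mono sum_mono mult_left_mono nonneg Suc.IH) auto
  also have "\<dots> = (\<Sum>b\<in>insert v (I - {a}). K a b)"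
    using I by simp
  also have "\<dots> \<le> - K a a"
    using I Suc.prems by (intro off_diagonal_sum) auto
  finally show ?case
    using diagonal_nonpos[of a]
    by (cases "K a a = 0") (auto simp: divide_le_eq_1 simp del: divide_minus_right)
qed simp

text \<open>Vertices of \<open>J - I\<close> count as 0 in the iteration for \<open>I\<close> but
  add nonnegative terms in the one for \<open>J\<close>.\<close>

lemma jacobi_mono_set:
  assumes J: "finite J" "v \<notin> J" and IJ: "I \<subseteq> J" and "a \<noteq> v"
  shows "jacobi K I v n a \<le> jacobi K J v n a"
  using assms(4)
proof (induction n arbitrary: a)
  case (Suc n)
  have "(\<Sum>b\<in>I - {a}. K a b * jacobi K I v n b) \<le> (\<Sum>b\<in>I - {a}. K a b * jacobi K J v n b)"
    using J IJ by (intro sum_mono mult_left_mono nonneg Suc.IH) auto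
  also have "\<dots> \<le> (\<Sum>b\<in>J - {a}. K a b * jacobi K J v n b)"
    using J IJ by (intro sum_mono2 mult_nonneg_nonneg nonneg jacobi_nonneg) auto
  finally show ?case
    using diagonal_nonpos[of a] by (auto intro!: divide_right_mono simp del: divide_minus_right)
qed simp

text \<open>The recursion is monotone in the previous iterate, and the first step goes up from
  0.\<close>

lemma jacobi_Suc_ge:
  assumes I: "finite I" "v \<notin> I" and "a \<noteq> v"
  shows "jacobi K I v n a \<le> jacobi K I v (Suc n) a"
  using assms(3)
proof (induction n arbitrary: a)
  case 0
  then show ?case using jacobi_nonneg[of v I a "Suc 0"] I by simp
next
  case (Suc n)
  have "(\<Sum>b\<in>I - {a}. K a b * jacobi K I v n b) \<le> (\<Sum>b\<in>I - {a}. K a b * jacobi K I v (Suc n) b)"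
    using I by (intro sum_mono mult_left_mono nonneg Suc.IH) auto
  then show ?case
    using diagonal_nonpos[of a]
    by (auto intro!: divide_right_mono simp del: divide_minus_right)
qed

lemma jacobi_tendsto_potential:
  assumes "finite I" "v \<notin> I" "a \<noteq> v"
  shows "(\<lambda>n. jacobi K I v n a) \<longlonglongrightarrow> potential K I v a"
proof -
  have "incseq (\<lambda>n. jacobi K I v n a)"
    using jacobi_Suc_ge[OF assms] by (rule incseq_SucI)
  moreover have "jacobi K I v n a \<le> 1" for n
    using assms by (rule jacobi_le_1)
  ultimately have "convergent (\<lambda>n. jacobi K I v n a)"
    by (meson incseq_convergent convergentI)
  then show ?thesis
    by (simp add: potential_def convergent_LIMSEQ_iff)
qed

lemma potential_bounds:
  assumes "finite I" "v \<notin> I" "a \<noteq> v"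
  shows "0 \<le> potential K I v a" "potential K I v a \<le> 1"
  using jacobi_tendsto_potential[OF assms] jacobi_nonneg[of v I a] jacobi_le_1[of I v a] assms
  by (auto intro: LIMSEQ_le_const LIMSEQ_le_const2)

lemma potential_mono:
  assumes "finite J" "v \<notin> J" "I \<subseteq> J" "a \<noteq> v"
  shows "potential K I v a \<le> potential K J v a"
  using assms finite_subset[of I J]
  by (intro LIMSEQ_le[OF jacobi_tendsto_potential[of I] jacobi_tendsto_potential[of J]])
    (auto intro: jacobi_mono_set)

lemma potential_equation:
  assumes I: "finite I" "v \<notin> I" and a: "a \<in> I"
  shows "(\<Sum>b\<in>I. K a b * potential K I v b) = - K a v"
proof -
  have av: "a \<noteq> v" using I a by auto
  have split: "(\<Sum>b\<in>I. K a b * potential K I v b) =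
      K a a * potential K I v a + (\<Sum>b\<in>I - {a}. K a b * potential K I v b)"
    using I a by (simp add: sum.remove)
  \<comment> \<open>Multiplying by \<open>- K a a\<close> undoes the division. If
    \<open>K a a = 0\<close>, all of row \<open>a\<close> vanishes and both sides are 0.\<close>
  have eq: "(- K a a) * jacobi K I v (Suc n) a = K a v + (\<Sum>b\<in>I - {a}. K a b * jacobi K I v n b)"
    (is "?l n = ?r n") for n
  proof (cases "K a a = 0")
    case True
    have zero: "K a b = 0" if "b \<noteq> a" for b
      using off_diagonal_sum[of "{b}" a] nonneg[of a b] that True by auto
    have "(\<Sum>b\<in>I - {a}. K a b * jacobi K I v n b) = 0"
      using zero by (intro sum.neutral) auto
    with True zero[of v] av show ?thesis by auto
  qed simp
  have "(\<lambda>n. ?l n) \<longlonglongrightarrow> (- K a a) * potential K I v a"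
    using jacobi_tendsto_potential[OF I av] by (intro tendsto_mult tendsto_const LIMSEQ_Suc)
  moreover have "?r \<longlonglongrightarrow> K a v + (\<Sum>b\<in>I - {a}. K a b * potential K I v b)"
    using I by (intro tendsto_intros jacobi_tendsto_potential) auto
  ultimately have "(- K a a) * potential K I v a = K a v + (\<Sum>b\<in>I - {a}. K a b * potential K I v b)"
    unfolding eq by (rule LIMSEQ_unique)
  with split show ?thesis by simp
qed

text \<open>The potential of \<open>v\<close> solves the column system of
  \<open>schur_complement_eq\<close>, and by symmetry of \<open>K\<close> the potential of
  \<open>u\<close> solves the row system.\<close>

lemma schur_complement_inner_response:
  assumes I: "finite I" and u: "u \<notin> I" and v: "v \<notin> I"
  shows "schur_complement K I u v = K u v + inner_response K I u v"
proof -
  have "(\<Sum>c\<in>I. potential K I u c * K c b) = - K u b" if "b \<in> I" for b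
    using potential_equation[OF I u that] by (simp add: sym[of b] mult.commute)
  then show ?thesis
    unfolding inner_response_def
    by (intro schur_complement_eq[OF I] potential_equation[OF I v])
qed

section \<open>Limits over growing sets of interior vertices\<close>

lemma inner_response_mono:
  assumes "finite J" "u \<notin> J" "v \<notin> J" "I \<subseteq> J"
  shows "inner_response K I u v \<le> inner_response K J u v"
proof -
  have "inner_response K I u v \<le> (\<Sum>d\<in>I. K u d * potential K J v d)"
    unfolding inner_response_def using assms
    by (intro sum_mono mult_left_mono nonneg potential_mono) auto
  also have "\<dots> \<le> inner_response K J u v"
    unfolding inner_response_def using assms
    by (intro sum_mono2 mult_nonneg_nonneg nonneg potential_bounds) auto
  finally show ?thesis .
qed

text \<open>The bound is independent of \<open>I\<close>, which makes the supremum finite.\<close>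

lemma inner_response_le:
  assumes "finite I" "u \<notin> I" "v \<notin> I"
  shows "inner_response K I u v \<le> - K u u"
proof -
  have "inner_response K I u v \<le> (\<Sum>d\<in>I. K u d * 1)"
    unfolding inner_response_def using assms
    by (intro sum_mono mult_left_mono nonneg potential_bounds) auto
  also have "\<dots> \<le> - K u u"
    using off_diagonal_sum[of I u] assms by simp
  finally show ?thesis .
qed

text \<open>Every finite \<open>I \<subseteq> J\<close> is eventually contained in
  \<open>W k\<close>, so by monotonicity the sequence passes every value below the supremum. The
  limit depends on \<open>W\<close> only through its union \<open>J\<close>.\<close>

lemma inner_response_tendsto:
  assumes J: "u \<notin> J" "v \<notin> J"
    and W: "\<And>k. finite (W k)" "incseq W" "(\<Union>k. W k) = J"
  shows "(\<lambda>k. K u v + inner_response K (W k) u v) \<longlonglongrightarrow> sup_response K J u v"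
  unfolding sup_response_def
proof (intro tendsto_add tendsto_const)
  let ?F = "{I. finite I \<and> I \<subseteq> J}" and ?g = "\<lambda>I. inner_response K I u v"
  have notin: "u \<notin> I" "v \<notin> I" if "I \<in> ?F" for I
    using that J by auto
  have WF: "W k \<in> ?F" for k using W by auto
  have bdd: "bdd_above (?g ` ?F)"
    using inner_response_le notin by (intro bdd_aboveI[of _ "- K u u"]) auto
  show "(\<lambda>k. ?g (W k)) \<longlonglongrightarrow> (SUP I\<in>?F. ?g I)"
  proof (rule order_tendstoI)
    fix x assume "x < (SUP I\<in>?F. ?g I)"
    then obtain I where I: "I \<in> ?F" "x < ?g I"
      using less_cSUP_iff[OF _ bdd, of x] by auto
    from I have "finite I" "I \<subseteq> (\<Union>k. W k)" using W by auto
    then have "\<forall>\<^sub>F k in sequentially. I \<subseteq> W k"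
      using W(2) by (intro eventually_subset_incseq)
    then show "\<forall>\<^sub>F k in sequentially. x < ?g (W k)"
    proof eventually_elim
      case (elim k)
      with I inner_response_mono[of "W k" u v I] notin[OF WF] W(1) show ?case
        by fastforce
    qed
  next
    fix x assume x: "(SUP I\<in>?F. ?g I) < x"
    have "?g (W k) < x" for k
      using cSUP_upper[OF WF bdd, of k] x by simp
    then show "\<forall>\<^sub>F k in sequentially. ?g (W k) < x" by simp
  qed
qed

end

lemma sup_response_image:
  assumes inj: "inj_on \<phi> (insert u (insert v J))"
    and K: "\<And>a b. a \<in> insert u (insert v J) \<Longrightarrow> b \<in> insert u (insert v J) \<Longrightarrow> K (\<phi> a) (\<phi> b) = K a b"
  shows "sup_response K (\<phi> ` J) (\<phi> u) (\<phi> v) = sup_response K J u v"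
proof -
  have inner: "inner_response K (\<phi> ` I) (\<phi> u) (\<phi> v) = inner_response K I u v" if I: "I \<subseteq> J" for I
  proof -
    have inj_I: "inj_on \<phi> I" using inj I by (auto intro: inj_on_subset)
    have "jacobi K (\<phi> ` I) (\<phi> v) n (\<phi> a) = jacobi K I v n a" if "a \<in> I" for n a
      using that
    proof (induction n arbitrary: a)
      case (Suc n)
      have "\<phi> ` I - {\<phi> a} = \<phi> ` (I - {a})"
        using inj_I Suc.prems by (auto dest: inj_onD)
      then have "(\<Sum>b\<in>\<phi> ` I - {\<phi> a}. K (\<phi> a) b * jacobi K (\<phi> ` I) (\<phi> v) n b)
          = (\<Sum>b\<in>I - {a}. K (\<phi> a) (\<phi> b) * jacobi K (\<phi> ` I) (\<phi> v) n (\<phi> b))"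
        using inj_I by (simp add: sum.reindex inj_on_diff)
      also have "\<dots> = (\<Sum>b\<in>I - {a}. K a b * jacobi K I v n b)"
        using Suc I by (intro sum.cong) (auto simp: K subset_iff)
      finally show ?case using Suc.prems I by (simp add: K subset_iff)
    qed simp
    then show ?thesis
      using inj_I I
      by (auto simp: inner_response_def potential_def sum.reindex K subset_iff intro!: sum.cong)
  qed
  have "{I. finite I \<and> I \<subseteq> \<phi> ` J} = (\<lambda>I. \<phi> ` I) ` {I. finite I \<and> I \<subseteq> J}"
    using finite_subset_image[of _ \<phi> J] by fast
  then show ?thesis
    by (simp add: sup_response_def K) (simp add: image_image inner)
qed


section \<open>Locally finite networks\<close>

text \<open>For distinct \<open>b\<close> the edges joining \<open>a\<close> to \<open>b\<close>
  form disjoint sets of edges incident to \<open>a\<close>, so their total conductance is at most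
  the one in the diagonal entry.\<close>

lemma kirchhoff_matrix_kirchhoff:
  fixes N :: "('v, 'e, 'z) network_scheme"
  assumes pos: "\<And>e. e \<in> edges N \<Longrightarrow> 0 \<le> conductance N e"
    and fin: "\<And>u. finite {e \<in> edges N. u \<in> ends N e}"
  shows "kirchhoff_matrix (kirchhoff N)"
proof
  fix a b
  show "kirchhoff N a b = kirchhoff N b a"
    by (simp add: kirchhoff_def insert_commute)
  show "0 \<le> kirchhoff N a b" if "a \<noteq> b"
    using that pos by (auto simp: kirchhoff_def intro: sum_nonneg)
next
  fix S :: "'v set" and a assume S: "finite S" "a \<in> S"
  let ?E = "\<lambda>b. {e \<in> edges N. ends N e = {a, b}}"
  have fin_E: "finite (?E b)" for b
    by (rule finite_subset[OF _ fin[of a]]) auto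
  have "(\<Sum>b\<in>S - {a}. kirchhoff N a b) = (\<Sum>b\<in>S - {a}. sum (conductance N) (?E b))"
    by (intro sum.cong) (auto simp: kirchhoff_def)
  also have "\<dots> = sum (conductance N) (\<Union>b\<in>S - {a}. ?E b)"
    using S fin_E by (intro sum.UNION_disjoint[symmetric]) (auto simp: doubleton_eq_iff)
  also have "\<dots> \<le> (\<Sum>e\<in>{e \<in> edges N. a \<in> ends N e}. conductance N e)"
    using fin pos by (intro sum_mono2) auto
  also have "\<dots> = - kirchhoff N a a"
    by (simp add: kirchhoff_def)
  finally show "(\<Sum>b\<in>S. kirchhoff N a b) \<le> 0"
    using S by (simp add: sum.remove)
qed

text \<open>All edges at a vertex of \<open>W\<close> survive truncation; rows of other vertices may
  lose edges.\<close>

lemma kirchhoff_truncation: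
  assumes "u \<in> W"
  shows "kirchhoff (truncation N W) u v = kirchhoff N u v"
proof -
  have "{e \<in> edges N. ends N e \<inter> W \<noteq> {} \<and> u \<in> ends N e} = {e \<in> edges N. u \<in> ends N e}"
    "{e \<in> edges N. ends N e \<inter> W \<noteq> {} \<and> ends N e = {u, v}} = {e \<in> edges N. ends N e = {u, v}}"
    using assms by auto
  then show ?thesis
    by (cases "u = v") (simp_all add: kirchhoff_def truncation_def Let_def conj_assoc)
qed

lemma interior_truncation: "verts (truncation N W) - bdry (truncation N W) = W - bdry N"
  by (auto simp: truncation_def Let_def)

lemma response_matrix_truncation_tendsto:
  assumes K: "kirchhoff_matrix (kirchhoff N)"
    and V: "exhaustion N V"
    and bdry: "bdry N \<subseteq> verts N" and u: "u \<in> bdry N" and v: "v \<in> bdry N"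
  shows "(\<lambda>k. response_matrix (truncation N (V k)) u v)
    \<longlonglongrightarrow> sup_response (kirchhoff N) (verts N - bdry N) u v"
proof (rule Lim_transform_eventually)
  interpret kirchhoff_matrix "kirchhoff N" by (rule K)
  let ?W = "\<lambda>k. V k - bdry N"
  have fin: "finite (V k)" and inc: "incseq V" and Un: "(\<Union>k. V k) = verts N" for k
    using V by (auto simp: exhaustion_def)
  show "(\<lambda>k. kirchhoff N u v + inner_response (kirchhoff N) (?W k) u v)
    \<longlonglongrightarrow> sup_response (kirchhoff N) (verts N - bdry N) u v"
    using u v fin Un inc
    by (intro inner_response_tendsto) (auto simp: incseq_def, blast)
  \<comment> \<open>The Schur complement reads only row \<open>u\<close> and rows of interior
    vertices in \<open>V k\<close>, so the truncated matrix can be replaced by the full one once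
    \<open>u\<close> lies in \<open>V k\<close>.\<close>
  have "\<forall>\<^sub>F k in sequentially. {u} \<subseteq> V k"
    using u bdry Un inc by (intro eventually_subset_incseq) auto
  then show "\<forall>\<^sub>F k in sequentially. kirchhoff N u v + inner_response (kirchhoff N) (?W k) u v
      = response_matrix (truncation N (V k)) u v"
  proof eventually_elim
    case (elim k)
    have "schur_complement (kirchhoff (truncation N (V k))) (?W k) u v
        = schur_complement (kirchhoff N) (?W k) u v"
      using elim by (intro schur_complement_cong kirchhoff_truncation) auto
    then show ?case
      using u v fin by (simp add: response_matrix_def interior_truncation
          schur_complement_inner_response)
  qed
qed


section \<open>The universal cover\<close>

lemma cover_proj_eq_iff:
  "cover_proj x = cover_proj y \<longleftrightarrow> fst x - fst y \<in> \<int> \<and> snd x = snd y"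
proof -
  have "cis (2 * pi * fst x) = cis (2 * pi * fst y) \<longleftrightarrow>
      (\<exists>n::int. 2 * pi * fst x = 2 * pi * fst y + 2 * pi * n)"
    by (subst sin_cos_eq_iff[symmetric]) (auto simp: complex_eq_iff)
  also have "\<dots> \<longleftrightarrow> (\<exists>n::int. fst x - fst y = n)"
  proof -
    have "2 * pi * a = 2 * pi * b + 2 * pi * n \<longleftrightarrow> a - b = n" for a b n :: real
    proof -
      have "2 * pi * a = 2 * pi * b + 2 * pi * n \<longleftrightarrow> 2 * pi * a = 2 * pi * (b + n)"
        by (simp only: distrib_left)
      then show ?thesis by auto
    qed
    then show ?thesis by simp
  qed
  finally show ?thesis
    by (auto simp: cover_proj_def Ints_def)
qed

text \<open>Uniqueness of path lifting: the horizontal difference of two lifts is continuous and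
  integer-valued on \<open>{0..1}\<close>, hence constant. Extensionality settles the values
  elsewhere.\<close>

lemma lifts_unique:
  assumes q: "q \<in> lifts g" "q' \<in> lifts g" and t: "t \<in> {0..1}" "q t = q' t"
  shows "q = q'"
proof -
  define d where "d = (\<lambda>t. fst (q t) - fst (q' t))"
  have proj: "d t \<in> \<int> \<and> snd (q t) = snd (q' t)" if "t \<in> {0..1}" for t
    using q that by (simp add: lifts_def d_def flip: cover_proj_eq_iff)
  have "d constant_on {0..1}"
  proof (rule continuous_discrete_range_constant)
    show "continuous_on {0..1} d"
      using q by (auto simp: lifts_def d_def path_def intro!: continuous_intros)
    show "\<exists>e>0. \<forall>y. y \<in> {0..1} \<and> d y \<noteq> d x \<longrightarrow> e \<le> norm (d y - d x)" if "x \<in> {0..1}" for x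
      using proj that Ints_nonzero_abs_ge1[OF Ints_diff] by (intro exI[of _ 1]) auto
  qed auto
  then have "d s = 0" if "s \<in> {0..1}" for s
    using t that by (metis constant_on_def d_def diff_self)
  with proj have "q s = q' s" if "s \<in> {0..1}" for s
    using that by (simp add: d_def prod_eq_iff)
  then show ?thesis
    using q by (intro extensionalityI[of _ "{0..1}"]) (auto simp: lifts_def)
qed

text \<open>Each of the finitely many edges of \<open>G\<close> has at most one lift starting at
  \<open>x\<close> and at most one ending there. This keeps the sums in \<open>kirchhoff\<close>
  finite; infinite ones would default to 0.\<close>

lemma finite_incident_universal_cover:
  assumes "cylindrical_network G"
  shows "finite {e \<in> edges (universal_cover G). x \<in> ends (universal_cover G) e}"
proof (rule finite_subset)
  let ?Q = "\<lambda>e t. {q \<in> lifts (curve G e). q t = x}"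
  have "finite (?Q e t)" if t: "t \<in> {0..1}" for e t
  proof (cases "?Q e t = {}")
    case False
    then obtain p where "p \<in> ?Q e t" by blast
    then have "?Q e t \<subseteq> {p}" using lifts_unique[OF _ _ t, of _ _ p] by auto
    then show ?thesis by (rule finite_subset) simp
  qed (simp only: finite.emptyI)
  then show "finite (SIGMA e:edges G. ?Q e 0 \<union> ?Q e 1)"
    using assms by (auto simp: cylindrical_network_def)
qed (auto simp: universal_cover_def pathstart_def pathfinish_def)

lemma kirchhoff_matrix_universal_cover:
  assumes "cylindrical_network G"
  shows "kirchhoff_matrix (kirchhoff (universal_cover G))"
  using assms finite_incident_universal_cover[OF assms]
  by (intro kirchhoff_matrix_kirchhoff)
    (auto simp: cylindrical_network_def electrical_network_def universal_cover_def less_imp_le)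

lemma bdry_subset_verts_universal_cover:
  assumes "cylindrical_network G"
  shows "bdry (universal_cover G) \<subseteq> verts (universal_cover G)"
  using assms by (auto simp: cylindrical_network_def electrical_network_def universal_cover_def)

section \<open>Action of deck transformations\<close>

lemma lifts_deck:
  assumes \<gamma>: "continuous_on strip \<gamma>" "\<gamma> ` strip \<subseteq> strip"
    and proj: "\<And>x. x \<in> strip \<Longrightarrow> cover_proj (\<gamma> x) = cover_proj x"
    and q: "q \<in> lifts g"
  shows "restrict (\<gamma> \<circ> q) {0..1} \<in> lifts g"
proof -
  have q_strip: "q t \<in> strip" if "t \<in> {0..1}" for t
    using q that by (auto simp: lifts_def path_image_def)
  have "continuous_on {0..1} (\<gamma> \<circ> q)"
    using q q_strip \<gamma> by (intro continuous_on_compose continuous_on_subset[OF \<gamma>(1)])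
      (auto simp: lifts_def path_def)
  then have "continuous_on {0..1} (restrict (\<gamma> \<circ> q) {0..1})"
    by (rule continuous_on_eq) auto
  then show ?thesis
    using q q_strip \<gamma>(2) proj by (auto simp: lifts_def path_def path_image_def)
qed

lemma deck_transformation_inverse:
  assumes "deck_transformation \<gamma>"
  obtains \<gamma>' where "homeomorphism strip strip \<gamma> \<gamma>'"
    "\<And>x. x \<in> strip \<Longrightarrow> cover_proj (\<gamma> x) = cover_proj x"
    "\<And>x. x \<in> strip \<Longrightarrow> cover_proj (\<gamma>' x) = cover_proj x"
proof -
  from assms obtain \<gamma>' where h: "homeomorphism strip strip \<gamma> \<gamma>'"
    and p: "\<And>x. x \<in> strip \<Longrightarrow> cover_proj (\<gamma> x) = cover_proj x"
    by (auto simp: deck_transformation_def)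
  have "cover_proj (\<gamma>' x) = cover_proj x" if "x \<in> strip" for x
    using p[of "\<gamma>' x"] imageI[of x strip \<gamma>'] that
    by (simp add: homeomorphism_apply2[OF h] homeomorphism_image2[OF h])
  with h p that show ?thesis by blast
qed

text \<open>Composing lifts with \<open>\<gamma>\<close> permutes the edges of the cover, preserves
  conductances and moves ends by \<open>\<gamma>\<close>.\<close>

lemma kirchhoff_deck:
  assumes \<gamma>: "deck_transformation \<gamma>" and ab: "a \<in> strip" "b \<in> strip"
  shows "kirchhoff (universal_cover G) (\<gamma> a) (\<gamma> b) = kirchhoff (universal_cover G) a b"
proof -
  obtain \<gamma>' where h: "homeomorphism strip strip \<gamma> \<gamma>'"
    and p: "\<And>x. x \<in> strip \<Longrightarrow> cover_proj (\<gamma> x) = cover_proj x"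
      "\<And>x. x \<in> strip \<Longrightarrow> cover_proj (\<gamma>' x) = cover_proj x"
    using deck_transformation_inverse[OF \<gamma>] by blast
  let ?N = "universal_cover G"
  \<comment> \<open>\<open>restrict\<close> makes the composed curve extensional again, as
    \<open>lifts\<close> demands.\<close>
  define F where "F \<phi> = (\<lambda>(e :: 'a, q). (e, restrict (\<phi> \<circ> q) {0..1 :: real}))"
    for \<phi> :: "real \<times> real \<Rightarrow> real \<times> real"
  have strip: "q t \<in> strip" if "(e, q) \<in> edges ?N" "t \<in> {0..1}" for e q t
    using that by (auto simp: universal_cover_def lifts_def path_image_def)
  have FE: "F \<phi> x \<in> edges ?N"
    if "\<phi> = \<gamma> \<or> \<phi> = \<gamma>'" "x \<in> edges ?N" for \<phi> x
    using that h p by (auto simp: universal_cover_def F_def homeomorphism_def intro!: lifts_deck)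
  have FF: "F \<phi> (F \<psi> x) = x"
    if \<phi>\<psi>: "\<phi> = \<gamma> \<and> \<psi> = \<gamma>' \<or> \<phi> = \<gamma>' \<and> \<psi> = \<gamma>" and x: "x \<in> edges ?N" for \<phi> \<psi> x
  proof -
    obtain e q where [simp]: "x = (e, q)" by (cases x)
    have "\<phi> (\<psi> y) = y" if "y \<in> strip" for y
      using homeomorphism_apply1[OF h that] homeomorphism_apply2[OF h that] \<phi>\<psi> by auto
    then have "restrict (\<phi> \<circ> restrict (\<psi> \<circ> q) {0..1}) {0..1} = q"
      using strip[of e q] x
      by (intro extensionalityI[of _ "{0..1}"]) (auto simp: universal_cover_def lifts_def)
    then show ?thesis by (simp add: F_def)
  qed
  have bij: "bij_betw (F \<gamma>) (edges ?N) (edges ?N)"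
    by (rule bij_betw_byWitness[where f' = "F \<gamma>'"]) (auto simp: FE FF)
  have ends: "ends ?N (F \<gamma> x) = \<gamma> ` ends ?N x" and cond: "conductance ?N (F \<gamma> x) = conductance ?N x"
    for x
    by (auto simp: F_def universal_cover_def pathstart_def pathfinish_def split: prod.split)
  have ends_strip: "ends ?N x \<subseteq> strip" if "x \<in> edges ?N" for x
    using that strip by (cases x) (auto simp: universal_cover_def pathstart_def pathfinish_def)
  have inj: "inj_on \<gamma> strip"
    using h by (auto simp: homeomorphism_def intro: inj_on_inverseI)
  \<comment> \<open>One reindexing serves both the incidence condition of the diagonal and the
    end-set condition off it.\<close>
  have sums: "(\<Sum>e\<in>{e \<in> edges ?N. P (ends ?N e)}. conductance ?N e)
      = (\<Sum>e\<in>{e \<in> edges ?N. Q (ends ?N e)}. conductance ?N e)"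
    if PQ: "\<And>A. A \<subseteq> strip \<Longrightarrow> P (\<gamma> ` A) \<longleftrightarrow> Q A" for P Q
  proof (rule sum.reindex_bij_betw[of "F \<gamma>", symmetric, THEN trans])
    show "bij_betw (F \<gamma>) {e \<in> edges ?N. Q (ends ?N e)} {e \<in> edges ?N. P (ends ?N e)}"
      by (rule bij_betw_Collect[OF bij]) (simp add: ends PQ ends_strip)
  qed (simp add: cond)
  have "\<gamma> a \<in> \<gamma> ` A \<longleftrightarrow> a \<in> A" if "A \<subseteq> strip" for A
    using inj ab that by (auto dest: inj_onD)
  moreover have "\<gamma> ` A = {\<gamma> a, \<gamma> b} \<longleftrightarrow> A = {a, b}" if "A \<subseteq> strip" for A
    using inj_on_image_eq_iff[OF inj that, of "{a, b}"] ab by auto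
  moreover have "\<gamma> a = \<gamma> b \<longleftrightarrow> a = b"
    using inj ab by (auto dest: inj_onD)
  ultimately show ?thesis
    unfolding kirchhoff_def
    using sums[of "\<lambda>A. \<gamma> a \<in> A" "\<lambda>A. a \<in> A"] sums[of "\<lambda>A. A = {\<gamma> a, \<gamma> b}" "\<lambda>A. A = {a, b}"]
    by (cases "a = b") simp_all
qed

text \<open>\<open>P\<close> will single out the interior vertices, the boundary, one side of it, or
  the whole strip.\<close>

lemma bij_betw_deck:
  assumes "deck_transformation \<gamma>"
  shows "bij_betw \<gamma> {x \<in> strip. P (cover_proj x)} {x \<in> strip. P (cover_proj x)}"
proof -
  obtain \<gamma>' where "homeomorphism strip strip \<gamma> \<gamma>'"
    "\<And>x. x \<in> strip \<Longrightarrow> cover_proj (\<gamma> x) = cover_proj x"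
    "\<And>x. x \<in> strip \<Longrightarrow> cover_proj (\<gamma>' x) = cover_proj x"
    using deck_transformation_inverse[OF assms] by blast
  then show ?thesis
    by (intro bij_betw_byWitness[where f' = \<gamma>']) (auto simp: homeomorphism_def)
qed

lemma sup_response_deck:
  fixes G :: "('e, 'z) embedded_network_scheme"
  defines "N \<equiv> universal_cover G"
  assumes \<gamma>: "deck_transformation \<gamma>" and u: "u \<in> bdry N" and v: "v \<in> bdry N"
  shows "sup_response (kirchhoff N) (verts N - bdry N) (\<gamma> u) (\<gamma> v)
    = sup_response (kirchhoff N) (verts N - bdry N) u v"
proof -
  let ?J = "verts N - bdry N"
  have J: "?J = {x \<in> strip. cover_proj x \<in> verts G - bdry G}"
    by (auto simp: N_def universal_cover_def)
  have "\<gamma> ` ?J = ?J"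
    unfolding J by (rule bij_betw_imp_surj_on[OF bij_betw_deck[OF \<gamma>]])
  moreover have sub: "insert u (insert v ?J) \<subseteq> strip"
    using u v by (auto simp: J) (auto simp: N_def universal_cover_def)
  have "sup_response (kirchhoff N) (\<gamma> ` ?J) (\<gamma> u) (\<gamma> v) = sup_response (kirchhoff N) ?J u v"
  proof (rule sup_response_image)
    show "inj_on \<gamma> (insert u (insert v ?J))"
      using bij_betw_imp_inj_on[OF bij_betw_deck[OF \<gamma>, of "\<lambda>_. True"]]
      by (rule inj_on_subset) (use sub in simp)
  qed (use sub in \<open>auto simp: N_def intro!: kirchhoff_deck[OF \<gamma>]\<close>)
  ultimately show ?thesis by simp
qed


section \<open>Numberings of the boundary\<close>

lemma deck_transformation_translation: "deck_transformation (\<lambda>x. (fst x + 1, snd x))"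
  unfolding deck_transformation_def
proof (intro conjI exI ballI)
  show "homeomorphism strip strip (\<lambda>x. (fst x + 1, snd x)) (\<lambda>x. (fst x - 1, snd x))"
    by (rule homeomorphismI) (auto simp: strip_def intro!: continuous_intros)
qed (simp add: cover_proj_eq_iff)

text \<open>If \<open>f (j + 1)\<close> exceeded \<open>f j + 1\<close>, a preimage of
  \<open>f j + 1\<close> would lie strictly between \<open>j\<close> and
  \<open>j + 1\<close>.\<close>

lemma strict_mono_surj_int:
  fixes f :: "int \<Rightarrow> int"
  assumes "strict_mono f" "surj f"
  shows "f i = f 0 + i"
proof -
  have step: "f (j + 1) = f j + 1" for j
  proof -
    obtain k where k: "f k = f j + 1" using assms(2) by (metis surjD)
    have "j < k" using k strict_mono_less[OF assms(1), of j k] by simp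
    moreover have "\<not> j + 1 < k"
      using k strict_mono_less[OF assms(1), of j "j + 1"] strict_mono_less[OF assms(1), of "j + 1" k]
      by linarith
    ultimately show ?thesis using k by (metis add1_zle_eq order_le_less)
  qed
  show ?thesis
  proof (induction i rule: int_induct[of _ 0])
    case (step1 i)
    then show ?case using step[of i] by simp
  next
    case (step2 i)
    then show ?case using step[of "i - 1"] by simp
  qed simp
qed

lemma boundary_numbering_period:
  assumes G: "cylindrical_network G" and l: "boundary_numbering G s l"
  shows "l (i + int (vertices_per_period G s)) = (fst (l i) + 1, snd (l i))"
proof -
  let ?\<tau> = "\<lambda>x :: real \<times> real. (fst x + 1, snd x)"
  define B where "B = {x \<in> bdry (universal_cover G). snd x = s}"
  have bij: "bij_betw l UNIV B" and mono: "strict_mono (\<lambda>i. fst (l i))"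
    using l by (auto simp: boundary_numbering_def B_def)
  have B_eq: "B = {x \<in> strip. cover_proj x \<in> {y \<in> bdry G. snd y = s}}"
    by (auto simp: B_def universal_cover_def cover_proj_def)
  have \<tau>: "bij_betw ?\<tau> B B"
    unfolding B_eq
    using bij_betw_deck[OF deck_transformation_translation, of "\<lambda>y. y \<in> {y \<in> bdry G. snd y = s}"] .
  \<comment> \<open>The unit translation, read on indices; it will turn out to be the shift by
    \<open>f 0\<close>.\<close>
  define f where "f = inv l \<circ> (?\<tau> \<circ> l)"
  have lf: "l (f i) = ?\<tau> (l i)" for i
  proof -
    have "?\<tau> (l i) \<in> range l"
      using bij bij_betw_apply[OF \<tau>, of "l i"] by (auto simp: bij_betw_def)
    then show ?thesis unfolding f_def o_def by (rule f_inv_into_f)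
  qed
  have less: "fst (l i) < fst (l j) \<longleftrightarrow> i < j" for i j
    using strict_mono_less[OF mono] by simp
  have "strict_mono f"
  proof (rule strict_monoI)
    fix i j :: int assume "i < j"
    then have "fst (l (f i)) < fst (l (f j))" by (simp add: lf less)
    then show "f i < f j" by (simp add: less)
  qed
  moreover have "surj f"
  proof -
    have "bij_betw (inv l) B UNIV" using bij by (rule bij_betw_inv_into)
    then have "bij_betw f UNIV UNIV"
      unfolding f_def using bij \<tau> by (intro bij_betw_trans)
    then show ?thesis by (simp add: bij_betw_def)
  qed
  ultimately have f: "f i = f 0 + i" for i by (rule strict_mono_surj_int)
  have l0: "fst (l (f 0)) = fst (l 0) + 1" by (simp add: lf)
  have lB: "l j \<in> B" for j using bij by (auto simp: bij_betw_def)
  \<comment> \<open>To identify \<open>f 0\<close>: the indices from \<open>0\<close> to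
    \<open>f 0 - 1\<close> are those of the vertices in the half-open window of length 1 starting at
    \<open>fst (l 0)\<close>, a fundamental domain for the covering.\<close>
  have "bij_betw (\<lambda>j. cover_proj (l j)) {0..<f 0} {y \<in> bdry G. snd y = s}"
    unfolding bij_betw_def
  proof (intro conjI inj_onI equalityI subsetI)
    fix i j assume ij: "i \<in> {0..<f 0}" "j \<in> {0..<f 0}" and eq: "cover_proj (l i) = cover_proj (l j)"
    have "fst (l 0) \<le> fst (l k) \<and> fst (l k) < fst (l 0) + 1" if "k \<in> {0..<f 0}" for k
      using that less[of k 0] less[of k "f 0"] l0 by auto
    from this[OF ij(1)] this[OF ij(2)] have "\<bar>fst (l i) - fst (l j)\<bar> < 1" by auto
    moreover have "fst (l i) - fst (l j) \<in> \<int>" using eq by (simp add: cover_proj_eq_iff)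
    ultimately have "fst (l i) = fst (l j)"
      using Ints_nonzero_abs_less1[of "fst (l i) - fst (l j)"] by auto
    then show "i = j" using less[of i j] less[of j i] by auto
  next
    fix y assume "y \<in> (\<lambda>j. cover_proj (l j)) ` {0..<f 0}"
    then show "y \<in> {y \<in> bdry G. snd y = s}" using lB by (auto simp: B_eq)
  next
    fix y assume y: "y \<in> {y \<in> bdry G. snd y = s}"
    then have "y \<in> cylinder"
      using G by (auto simp: cylindrical_network_def electrical_network_def)
    then have s: "s \<in> {0..1}" and "cmod (fst y) = 1" using y by (auto simp: cylinder_def)
    then have y_cis: "fst y = cis (Arg (fst y))"
      by (metis cis_Arg norm_zero zero_neq_one sgn_eq div_by_1 of_real_1)
    define r where "r = Arg (fst y) / (2 * pi)"
    \<comment> \<open>An integer shift moves the preimage \<open>r\<close> into that window.\<close>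
    define t where "t = r - of_int \<lfloor>r - fst (l 0)\<rfloor>"
    have t: "fst (l 0) \<le> t" "t < fst (l 0) + 1"
      unfolding t_def by linarith+
    have "cover_proj (t, s) = cover_proj (r, s)"
      by (simp add: cover_proj_eq_iff t_def)
    also have "\<dots> = y"
      using y y_cis by (simp add: cover_proj_def r_def prod_eq_iff)
    finally have cov: "cover_proj (t, s) = y" .
    then have "(t, s) \<in> B" using y s by (simp add: B_eq strip_def)
    then obtain j where j: "l j = (t, s)" using bij by (auto simp: bij_betw_def image_iff)
    then have "j \<in> {0..<f 0}" using t less[of j 0] less[of j "f 0"] l0 by auto
    then show "y \<in> (\<lambda>j. cover_proj (l j)) ` {0..<f 0}"
      using cov by (intro image_eqI[of _ _ j]) (auto simp: j)
  qed
  then have "card {0..<f 0} = vertices_per_period G s"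
    unfolding vertices_per_period_def by (rule bij_betw_same_card)
  \<comment> \<open>Positivity is needed because the cardinality of the index interval is
    \<open>nat (f 0)\<close>.\<close>
  moreover have "0 < f 0"
    using less[of 0 "f 0"] l0 by auto
  ultimately have "int (vertices_per_period G s) = f 0" by auto
  then show ?thesis using lf[of i] f[of i] by (simp add: add.commute)
qed

theorem theorem5p2:
  fixes G :: "'e embedded_network"
    and V :: "nat \<Rightarrow> (real \<times> real) set"
  assumes "cylindrical_network G"
    and "exhaustion (universal_cover G) V"
  shows "(\<forall>u\<in>bdry (universal_cover G). \<forall>v\<in>bdry (universal_cover G).
            convergent (truncated_response G V u v)) \<and>
         (\<forall>V'. exhaustion (universal_cover G) V' \<longrightarrow>
            (\<forall>u\<in>bdry (universal_cover G). \<forall>v\<in>bdry (universal_cover G).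
               limit_response G V' u v = limit_response G V u v)) \<and>
         (\<forall>\<gamma>. deck_transformation \<gamma> \<longrightarrow>
            (\<forall>u\<in>bdry (universal_cover G). \<forall>v\<in>bdry (universal_cover G).
               limit_response G V (\<gamma> u) (\<gamma> v) = limit_response G V u v)) \<and>
         (\<forall>s\<in>{0, 1}. \<forall>l. boundary_numbering G s l \<longrightarrow>
            (\<forall>i j. limit_response G V (l (i + int (vertices_per_period G s)))
                                      (l (j + int (vertices_per_period G s))) =
                   limit_response G V (l i) (l j)))"
proof -
  let ?N = "universal_cover G"
  let ?L = "sup_response (kirchhoff ?N) (verts ?N - bdry ?N)"
  \<comment> \<open>The limit \<open>?L\<close> does not mention \<open>W\<close>, which gives
    independence of the exhaustion.\<close>
  have conv: "truncated_response G W u v \<longlonglongrightarrow> ?L u v"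
    if "exhaustion ?N W" "u \<in> bdry ?N" "v \<in> bdry ?N" for W u v
    using response_matrix_truncation_tendsto[OF kirchhoff_matrix_universal_cover[OF assms(1)]
        that(1) bdry_subset_verts_universal_cover[OF assms(1)] that(2,3)]
    by (simp add: truncated_response_def[abs_def])
  then have lim: "limit_response G W u v = ?L u v"
    if "exhaustion ?N W" "u \<in> bdry ?N" "v \<in> bdry ?N" for W u v
    unfolding limit_response_def using that by (intro limI)
  have deck: "limit_response G V (\<gamma> u) (\<gamma> v) = limit_response G V u v"
    if \<gamma>: "deck_transformation \<gamma>" and uv: "u \<in> bdry ?N" "v \<in> bdry ?N" for \<gamma> u v
  proof -
    have "\<gamma> w \<in> bdry ?N" if "w \<in> bdry ?N" for w
      using bij_betw_apply[OF bij_betw_deck[OF \<gamma>, of "\<lambda>y. y \<in> bdry G"]] that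
      by (simp add: universal_cover_def)
    then show ?thesis
      using uv by (simp add: lim assms(2) sup_response_deck[OF \<gamma>])
  qed
  have period: "limit_response G V (l (i + int (vertices_per_period G s)))
      (l (j + int (vertices_per_period G s))) = limit_response G V (l i) (l j)"
    if l: "boundary_numbering G s l" for s l i j
  proof -
    have "l k \<in> bdry ?N" for k
      using l by (auto simp: boundary_numbering_def bij_betw_def)
    then show ?thesis
      using deck[OF deck_transformation_translation]
      by (simp add: boundary_numbering_period[OF assms(1) l])
  qed
  show ?thesis
    by (intro conjI ballI allI impI)
      (simp_all add: convergentI[OF conv[OF assms(2)]] lim assms(2) deck period)
qed

end
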